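(* Let $H$ be a real Hilbert space, let $A$ and $B$ be closed and convex sets in $H$, let $x_0, q\in H$ and $\alpha,\beta\in(0,1)$, and let $\{x_n\}$ and $\{y_n\}$ be the sequences generated from $x_0$ by $$y_n=P_A(x_n+q),\qquad x_{n+1}=T_{A-q,B-q,\alpha,\beta}(x_n),\qquad n=0,1,2,\dots.$$ For $x\in H$ let $r(x)=\|P_A(x+q)-P_B(P_A(x+q))\|$ (so that $r(x_n)=\|y_n-P_B(y_n)\|$). If $A\cap B\neq\emptyset$ and $q-P_{A\cap B}(q)\in (N_A+N_B)(P_{A\cap B}(q))$, then $r(x_n)=o\left(\frac{1}{\sqrt{n}}\right)$, i.e. $\lim_{n\to\infty}\sqrt{n}\,r(x_n)=0$.
   Context: $H$ is a real Hilbert space with inner product $\langle\cdot,\cdot\rangle$ and norm $\|\cdot\|$. For a nonempty closed convex set $C\subset H$, $P_C$ denotes the metric projection onto $C$: $P_C(x)$ is the unique minimizer of $\|x-y\|$ over $y\in C$. For $x\in C$, the normal cone to $C$ at $x$ is $N_C(x)=\{v\in H:\langle v,y-x\rangle\le 0 \text{ for all } y\in C\}$, and $(N_A+N_B)(x)=N_A(x)+N_B(x)=\{v+w: v\in N_A(x),\ w\in N_B(x)\}$. For $C\subset H$ and $p\in H$, $C-p=\{c-p:c\in C\}$. For nonempty closed convex sets $C,D\subset H$ and $\alpha,\beta\in(0,1)$, the averaged alternating modified reflections (AAMR) operator $T_{C,D,\alpha,\beta}:H\to H$ is $$T_{C,D,\alpha,\beta}=(1-\alpha)I+\alpha(2\beta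 P_D-I)(2\beta P_C-I),$$ where $I$ is the identity mapping and juxtaposition denotes composition. *)

theory Defs
  imports "HOL-Analysis.Analysis" "HOL-Library.Set_Algebras" "HOL-Library.Landau_Symbols"
begin

(* The library's closest_point requires heine_borel, which for inner product spaces means
   finite dimension. As usual with THE, the value is unspecified where there is no unique
   minimizer; by the projection theorem there is one for nonempty closed convex C in a
   Hilbert space. *)
definition metric_proj :: "'a::real_inner set \<Rightarrow> 'a \<Rightarrow> 'a" where
  "metric_proj C x = (THE p. is_arg_min (\<lambda>y. norm (x - y)) (\<lambda>y. y \<in> C) p)"

(* Empty at points outside C (only points of C matter). *)
definition normal_cone :: "'a::real_inner set \<Rightarrow> 'a \<Rightarrow> 'a set" where
  "normal_cone C x = (if x \<in> C then {v. \<forall>y\<in>C. inner v (y - x) \<le> 0} else {})"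

definition translate_by_minus :: "'a::real_inner set \<Rightarrow> 'a \<Rightarrow> 'a set" where
  "translate_by_minus C p = (\<lambda>c. c - p) ` C"

definition modified_reflector :: "'a::real_inner set \<Rightarrow> real \<Rightarrow> 'a \<Rightarrow> 'a" where
  "modified_reflector C \<beta> x = (2 * \<beta>) *\<^sub>R metric_proj C x - x"

definition aamr :: "'a::real_inner set \<Rightarrow> 'a set \<Rightarrow> real \<Rightarrow> real \<Rightarrow> 'a \<Rightarrow> 'a" where
  "aamr C D \<alpha> \<beta> x =
     (1 - \<alpha>) *\<^sub>R x + \<alpha> *\<^sub>R (modified_reflector D \<beta> \<circ> modified_reflector C \<beta>) x"

definition aamr_residual :: "'a::real_inner set \<Rightarrow> 'a set \<Rightarrow> 'a \<Rightarrow> 'a \<Rightarrow> real" where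
  "aamr_residual A B q x =
     norm (metric_proj A (x + q) - metric_proj B (metric_proj A (x + q)))"

end

theory Submission
  imports Defs
begin

text \<open>
  Put C = A - q and D = B - q, and write R for the modified reflectors. With w = R_C x one has
  R_D w - x = 2\<beta>(P_D w - P_C x), so the displacement of the nonexpansive map N = R_D R_C at x
  is at least 2\<beta> times the distance of P_C x to D, which is r(x). The cone condition
  q - p = u + v with u, v normal to A, B at p provides the fixed point
  z = (p - q) + 2(1 - \<beta>)u of N. For the averaged iteration x' = (1 - \<alpha>)x + \<alpha> N x the
  displacements d decrease and satisfy
  \<alpha>(1 - \<alpha>) d(n)^2 \<le> |x(n) - z|^2 - |x(n+1) - z|^2, so summing from n/2 to n gives
  n d(n)^2 \<rightarrow> 0.
\<close>

section \<open>Metric projections and translates\<close>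

text \<open>Expanding the square at \<open>p\<close> turns the obtuse-angle condition into |x - y|^2
  >= |x - p|^2 + |y - p|^2, which yields minimality and uniqueness at once. This is how projections
  are evaluated at explicit points below.\<close>

lemma metric_proj_eqI:
  fixes C :: "'a::real_inner set"
  assumes "p \<in> C" and var: "\<And>y. y \<in> C \<Longrightarrow> inner (x - p) (y - p) \<le> 0"
  shows "metric_proj C x = p"
proof -
  have expand: "(norm (x - y))\<^sup>2 \<ge> (norm (x - p))\<^sup>2 + (norm (y - p))\<^sup>2" if "y \<in> C" for y
  proof -
    have "(norm (x - y))\<^sup>2 = (norm (x - p))\<^sup>2 + (norm (y - p))\<^sup>2 - 2 * inner (x - p) (y - p)"
      by (simp add: power2_norm_eq_inner inner_diff_left inner_diff_right inner_commute)
    with var[OF that] show ?thesis by linarith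
  qed
  have min: "is_arg_min (\<lambda>y. norm (x - y)) (\<lambda>y. y \<in> C) p"
  proof -
    have "norm (x - p) \<le> norm (x - y)" if "y \<in> C" for y
      using expand[OF that] zero_le_power2[of "norm (y - p)"]
      by (intro power2_le_imp_le[OF _ norm_ge_zero]) linarith
    then show ?thesis
      using \<open>p \<in> C\<close> by (auto simp: is_arg_min_def not_less)
  qed
  have uniq: "y = p" if "is_arg_min (\<lambda>y. norm (x - y)) (\<lambda>y. y \<in> C) y" for y
  proof -
    have "y \<in> C" "norm (x - y) \<le> norm (x - p)"
      using that \<open>p \<in> C\<close> by (auto simp: is_arg_min_def not_less)
    then have "(norm (x - y))\<^sup>2 \<le> (norm (x - p))\<^sup>2"
      by (simp add: power_mono)
    with expand[OF \<open>y \<in> C\<close>] have "(norm (y - p))\<^sup>2 \<le> 0" by linarith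
    then show "y = p" by simp
  qed
  show ?thesis
    unfolding metric_proj_def using min uniq by (rule the_equality)
qed

text \<open>A minimizing sequence is Cauchy: by convexity midpoints stay in \<open>C\<close>, so the
  parallelogram law controls the distance between two near-minimizers. Completeness and closedness
  then give a limit in \<open>C\<close>.\<close>

lemma exists_closest_point:
  fixes C :: "'a::{real_inner, complete_space} set"
  assumes "closed C" "convex C" "C \<noteq> {}"
  shows "\<exists>p\<in>C. \<forall>y\<in>C. dist x p \<le> dist x y"
proof -
  define S where "S = (\<lambda>y. (norm (x - y))\<^sup>2) ` C"
  have "S \<noteq> {}" using assms(3) by (auto simp: S_def)
  have "bdd_below S" unfolding S_def by (intro bdd_belowI2[where m = 0]) simp
  have lower: "Inf S \<le> (norm (x - y))\<^sup>2" if "y \<in> C" for y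
    using \<open>bdd_below S\<close> that by (auto simp: S_def intro: cInf_lower)
  have "\<exists>y\<in>C. (norm (x - y))\<^sup>2 < Inf S + inverse (real (Suc n))" for n
    using cInf_lessD[OF \<open>S \<noteq> {}\<close>, of "Inf S + inverse (real (Suc n))"] by (auto simp: S_def)
  then obtain s where sC: "\<And>n. s n \<in> C"
    and s: "\<And>n. (norm (x - s n))\<^sup>2 < Inf S + inverse (real (Suc n))"
    by metis
  \<comment> \<open>Each squared distance to \<open>x\<close> is below \<open>Inf S\<close> plus an
    error, while the midpoint's is at least \<open>Inf S\<close>. Hence 2 \<open>Inf S\<close> + 2
    \<open>Inf S\<close> - 4 \<open>Inf S\<close> cancels and only the errors remain.\<close>
  have close: "(dist (s m) (s n))\<^sup>2 \<le> 2 * inverse (real (Suc m)) + 2 * inverse (real (Suc n))" for m n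
  proof -
    let ?h = "(1/2) *\<^sub>R s m + (1/2) *\<^sub>R s n"
    have "?h \<in> C" using assms(2) sC by (simp add: convexD)
    have parallelogram: "(dist (s m) (s n))\<^sup>2
        = 2 * (norm (x - s m))\<^sup>2 + 2 * (norm (x - s n))\<^sup>2 - 4 * (norm (x - ?h))\<^sup>2"
      unfolding dist_norm
      by (simp add: power2_norm_eq_inner inner_diff_left inner_diff_right inner_add_left
          inner_add_right inner_commute field_simps)
    show ?thesis
      using parallelogram lower[OF \<open>?h \<in> C\<close>] s[of m] s[of n] by linarith
  qed
  have "Cauchy s"
  proof (rule metric_CauchyI)
    fix e :: real assume "e > 0"
    then obtain M where M: "inverse (real (Suc M)) < e\<^sup>2 / 4"
      \<comment> \<open>The factor 4 matches the two summands of \<open>close\<close>, each with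
        coefficient 2.\<close>
      using reals_Archimedean[of "e\<^sup>2 / 4"] by auto
    have "dist (s m) (s n) < e" if "M \<le> m" "M \<le> n" for m n
    proof (rule power2_less_imp_less)
      have "inverse (real (Suc m)) \<le> inverse (real (Suc M))"
        "inverse (real (Suc n)) \<le> inverse (real (Suc M))"
        using that by auto
      with close[of m n] M show "(dist (s m) (s n))\<^sup>2 < e\<^sup>2" by linarith
    qed (use \<open>e > 0\<close> in simp)
    then show "\<exists>M. \<forall>m\<ge>M. \<forall>n\<ge>M. dist (s m) (s n) < e" by blast
  qed
  then obtain p where p: "s \<longlonglongrightarrow> p" using Cauchy_convergent convergent_def by blast
  have "p \<in> C" using \<open>closed C\<close> sC p by (rule closed_sequentially)
  have "(norm (x - p))\<^sup>2 \<le> Inf S + 0"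
  proof (rule LIMSEQ_le)
    show "(\<lambda>n. (norm (x - s n))\<^sup>2) \<longlonglongrightarrow> (norm (x - p))\<^sup>2" by (intro tendsto_intros p)
    show "(\<lambda>n. Inf S + inverse (real (Suc n))) \<longlonglongrightarrow> Inf S + 0"
      by (intro tendsto_intros LIMSEQ_inverse_real_of_nat)
    show "\<exists>N. \<forall>n\<ge>N. (norm (x - s n))\<^sup>2 \<le> Inf S + inverse (real (Suc n))"
      using s less_imp_le by blast
  qed
  then have "norm (x - p) \<le> norm (x - y)" if "y \<in> C" for y
    using lower[OF that] by (intro power2_le_imp_le[OF _ norm_ge_zero]) linarith
  with \<open>p \<in> C\<close> show ?thesis by (auto simp: dist_norm)
qed

text \<open>A closest point satisfies the variational inequality, so \<open>metric_proj_eqI\<close>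
  identifies it with the value chosen by \<open>THE\<close>.\<close>

lemma
  fixes C :: "'a::{real_inner, complete_space} set"
  assumes "closed C" "convex C" "C \<noteq> {}"
  shows metric_proj_in: "metric_proj C x \<in> C"
    and metric_proj_dot: "\<And>y. y \<in> C \<Longrightarrow> inner (x - metric_proj C x) (y - metric_proj C x) \<le> 0"
    and metric_proj_le: "\<And>y. y \<in> C \<Longrightarrow> norm (x - metric_proj C x) \<le> norm (x - y)"
proof -
  obtain p where p: "p \<in> C" "\<forall>y\<in>C. dist x p \<le> dist x y"
    using exists_closest_point[OF assms] by blast
  have var: "inner (x - p) (y - p) \<le> 0" if "y \<in> C" for y
    using any_closest_point_dot[OF assms(2,1) p(1) that p(2)] .
  have eq: "metric_proj C x = p" using p(1) var by (rule metric_proj_eqI)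
  show "metric_proj C x \<in> C" using eq p by simp
  show "inner (x - metric_proj C x) (y - metric_proj C x) \<le> 0" if "y \<in> C" for y
    using eq var[OF that] by simp
  show "norm (x - metric_proj C x) \<le> norm (x - y)" if "y \<in> C" for y
    using eq p that by (simp add: dist_norm)
qed

lemma
  fixes C :: "'a::real_inner set"
  shows closed_translate_by_minus: "closed C \<Longrightarrow> closed (translate_by_minus C q)"
    and convex_translate_by_minus: "convex C \<Longrightarrow> convex (translate_by_minus C q)"
    and translate_by_minus_eq_empty_iff: "translate_by_minus C q = {} \<longleftrightarrow> C = {}"
    and mem_translate_by_minus_iff: "x \<in> translate_by_minus C q \<longleftrightarrow> x + q \<in> C"
proof -
  show "closed C \<Longrightarrow> closed (translate_by_minus C q)"
    using closed_translation_subtract[of C q] by (simp add: translate_by_minus_def)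
  show "convex C \<Longrightarrow> convex (translate_by_minus C q)"
    using convex_translation_subtract_eq[of q C] by (simp add: translate_by_minus_def)
  show "translate_by_minus C q = {} \<longleftrightarrow> C = {}" by (simp add: translate_by_minus_def)
  show "x \<in> translate_by_minus C q \<longleftrightarrow> x + q \<in> C"
    unfolding translate_by_minus_def by (auto intro: image_eqI[of _ _ "x + q"])
qed

text \<open>Shifting by \<open>q\<close> leaves all difference vectors unchanged, hence also the
  variational inequality.\<close>

lemma metric_proj_translate_by_minus:
  fixes C :: "'a::{real_inner, complete_space} set"
  assumes "closed C" "convex C" "C \<noteq> {}"
  shows "metric_proj (translate_by_minus C q) x = metric_proj C (x + q) - q"
proof (rule metric_proj_eqI)
  show "metric_proj C (x + q) - q \<in> translate_by_minus C q"
    using metric_proj_in[OF assms] by (simp add: mem_translate_by_minus_iff)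
  show "inner (x - (metric_proj C (x + q) - q)) (y - (metric_proj C (x + q) - q)) \<le> 0"
    if "y \<in> translate_by_minus C q" for y
    using metric_proj_dot[OF assms, of "y + q" "x + q"] that
    by (simp add: mem_translate_by_minus_iff algebra_simps)
qed

section \<open>Modified reflectors and their composition\<close>

text \<open>Add two variational inequalities: the one for \<open>x\<close> tested at the projection
  of \<open>y\<close>, and the one with the roles exchanged.\<close>

lemma metric_proj_firmly_nonexpansive:
  fixes C :: "'a::{real_inner, complete_space} set"
  assumes "closed C" "convex C" "C \<noteq> {}"
  shows "(norm (metric_proj C x - metric_proj C y))\<^sup>2 \<le> inner (metric_proj C x - metric_proj C y) (x - y)"
proof -
  have "inner (a - b) (x - y) - (norm (a - b))\<^sup>2 = - inner (x - a) (b - a) - inner (y - b) (a - b)"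
    for a b :: 'a
    by (simp add: power2_norm_eq_inner inner_diff_left inner_diff_right inner_commute)
  from this[of "metric_proj C x" "metric_proj C y"] show ?thesis
    using metric_proj_dot[OF assms metric_proj_in[OF assms], of x y]
      metric_proj_dot[OF assms metric_proj_in[OF assms], of y x]
    by linarith
qed

text \<open>In |2 \<beta> d - (x - y)|^2 the terms 4 \<beta>^2 |d|^2 - 4 \<beta> <d, x - y> have
  nonpositive sum, by firm nonexpansiveness and \<beta>^2 \<le> \<beta>.\<close>

lemma modified_reflector_nonexpansive:
  fixes C :: "'a::{real_inner, complete_space} set"
  assumes "closed C" "convex C" "C \<noteq> {}" "0 \<le> \<beta>" "\<beta> \<le> 1"
  shows "norm (modified_reflector C \<beta> x - modified_reflector C \<beta> y) \<le> norm (x - y)"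
proof (rule power2_le_imp_le)
  let ?d = "metric_proj C x - metric_proj C y"
  have "\<beta> * \<beta> \<le> \<beta>" using assms(4,5) by (simp add: mult_left_le)
  then have "\<beta> * \<beta> * (norm ?d)\<^sup>2 \<le> \<beta> * (norm ?d)\<^sup>2"
    by (rule mult_right_mono) simp
  also have "\<dots> \<le> \<beta> * inner ?d (x - y)"
    using metric_proj_firmly_nonexpansive[OF assms(1-3)] assms(4) by (rule mult_left_mono)
  finally have le: "\<beta> * \<beta> * (norm ?d)\<^sup>2 \<le> \<beta> * inner ?d (x - y)" .
  have "modified_reflector C \<beta> x - modified_reflector C \<beta> y = (2 * \<beta>) *\<^sub>R ?d - (x - y)"
    by (simp add: modified_reflector_def algebra_simps)
  then have "(norm (modified_reflector C \<beta> x - modified_reflector C \<beta> y))\<^sup>2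
      = (norm ((2 * \<beta>) *\<^sub>R ?d - (x - y)))\<^sup>2" by simp
  also have "\<dots> = 4 * (\<beta> * \<beta> * (norm ?d)\<^sup>2) - 4 * (\<beta> * inner ?d (x - y)) + (norm (x - y))\<^sup>2"
    unfolding power2_norm_eq_inner inner_diff_left[of _ "x - y"] inner_diff_right[of _ _ "x - y"]
    by (simp add: inner_commute[of "x - y" ?d])
  also have "\<dots> \<le> (norm (x - y))\<^sup>2" using le by linarith
  finally show "(norm (modified_reflector C \<beta> x - modified_reflector C \<beta> y))\<^sup>2 \<le> (norm (x - y))\<^sup>2" .
qed simp

text \<open>With w the reflection of \<open>x\<close> in \<open>C\<close>, the vector subtracted
  from 2 \<beta> P_D w is w + x = 2 \<beta> P_C x.\<close>

lemma modified_reflector_composition_displacement: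
  "(modified_reflector D \<beta> \<circ> modified_reflector C \<beta>) x - x
     = (2 * \<beta>) *\<^sub>R (metric_proj D (modified_reflector C \<beta> x) - metric_proj C x)"
  by (simp add: modified_reflector_def[of D] scaleR_diff_right) (simp add: modified_reflector_def)

text \<open>Moving from \<open>p\<close> along a normal vector does not change the projection, so
  \<open>z\<close> projects to \<open>p\<close> on \<open>C\<close>. Its reflection is
  \<open>p\<close> plus a nonnegative multiple of \<open>v\<close>, which projects to
  \<open>p\<close> on \<open>D\<close>. The displacement formula then gives zero.\<close>

lemma modified_reflector_composition_fixpoint:
  fixes C D :: "'a::real_inner set"
  assumes "\<beta> \<le> 1" and u: "u \<in> normal_cone C p" and v: "v \<in> normal_cone D p" and "- p = u + v"
  defines "z \<equiv> p + (2 * (1 - \<beta>)) *\<^sub>R u"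
  shows "(modified_reflector D \<beta> \<circ> modified_reflector C \<beta>) z = z"
proof -
  \<comment> \<open>Membership is available because \<open>normal_cone\<close> is empty at points
    outside the set.\<close>
  have p: "p \<in> C" "p \<in> D"
    and u': "\<And>y. y \<in> C \<Longrightarrow> inner u (y - p) \<le> 0" and v': "\<And>y. y \<in> D \<Longrightarrow> inner v (y - p) \<le> 0"
    using u v by (auto simp: normal_cone_def split: if_splits)
  have C: "metric_proj C z = p"
    using p(1) by (rule metric_proj_eqI)
      (use u' \<open>\<beta> \<le> 1\<close> in \<open>auto simp: z_def intro!: mult_nonneg_nonpos\<close>)
  have w: "modified_reflector C \<beta> z = p + (2 * (1 - \<beta>)) *\<^sub>R v"
  proof -
    \<comment> \<open>An identity in \<open>p\<close>, \<open>u\<close>, \<open>v\<close>; its last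
      summand vanishes by the relation - p = u + v.\<close>
    have "(2 * \<beta>) *\<^sub>R p - z = p + (2 * (1 - \<beta>)) *\<^sub>R v + (2 * (1 - \<beta>)) *\<^sub>R (- p - (u + v))"
      by (simp add: z_def algebra_simps flip: scaleR_2)
    then show ?thesis
      using \<open>- p = u + v\<close> by (simp add: modified_reflector_def C)
  qed
  have D: "metric_proj D (modified_reflector C \<beta> z) = p"
    using p(2) unfolding w by (rule metric_proj_eqI)
      (use v' \<open>\<beta> \<le> 1\<close> in \<open>auto intro!: mult_nonneg_nonpos\<close>)
  show ?thesis
    using modified_reflector_composition_displacement[of D \<beta> C z] by (simp add: C D)
qed

lemma normal_cone_translate_by_minus:
  "normal_cone (translate_by_minus C q) (p - q) = normal_cone C p"
  by (auto simp: normal_cone_def translate_by_minus_def)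

section \<open>Rate of the averaged iteration\<close>

text \<open>Summing only over the block from n/2 to n bounds n a(n) / 2 by S(n/2) - S(n), which
  tends to 0 because \<open>S\<close> converges. Summing from 0 would give mere boundedness.\<close>

lemma antimono_telescoping_little_o:
  fixes a S :: "nat \<Rightarrow> real"
  assumes a: "\<And>n. 0 \<le> a n" "antimono a" and S: "\<And>n. 0 \<le> S n"
    and le: "\<And>n. a n \<le> S n - S (Suc n)"
  shows "(\<lambda>n. real n * a n) \<longlonglongrightarrow> 0"
proof (rule tendsto_sandwich[where f = \<open>\<lambda>_. 0\<close>])
  have "S (Suc n) \<le> S n" for n
    using le[of n] a(1)[of n] by linarith
  then have "decseq S" by (rule decseq_SucI)
  then obtain L where L: "S \<longlonglongrightarrow> L"
    using decseq_convergent[of S 0] S by metis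
  have "\<forall>n\<ge>2 * Z. Z \<le> n div 2" for Z :: nat by auto
  then have "filterlim (\<lambda>n::nat. n div 2) at_top at_top"
    unfolding filterlim_at_top eventually_sequentially by blast
  from filterlim_compose[OF L this]
  have "(\<lambda>n. 2 * (S (n div 2) - S n)) \<longlonglongrightarrow> 2 * (L - L)"
    by (intro tendsto_intros L)
  then show "(\<lambda>n. 2 * (S (n div 2) - S n)) \<longlonglongrightarrow> 0" by simp
  have "real n * a n \<le> 2 * (S (n div 2) - S n)" for n
  proof -
    \<comment> \<open>Rounding down in \<open>n div 2\<close> makes the block contain at least half
      of n indices.\<close>
    have "n \<le> 2 * card {n div 2..<n}" by auto
    then have "real n \<le> 2 * real (card {n div 2..<n})" by linarith
    then have "real n * a n \<le> 2 * real (card {n div 2..<n}) * a n"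
      using a(1) by (rule mult_right_mono)
    also have "\<dots> = 2 * (real (card {n div 2..<n}) * a n)" by (rule mult.assoc)
    also have "real (card {n div 2..<n}) * a n \<le> (\<Sum>k = n div 2..<n. a k)"
      using a(2) by (intro sum_bounded_below) (auto simp: antimono_def)
    also have "\<dots> \<le> (\<Sum>k = n div 2..<n. S k - S (Suc k))"
      by (intro sum_mono le)
    also have "\<dots> = S (n div 2) - S n"
      using sum_Suc_diff'[of "n div 2" n S] by (simp add: sum_subtractf algebra_simps)
    finally show ?thesis by simp
  qed
  then show "\<forall>\<^sub>F n in sequentially. real n * a n \<le> 2 * (S (n div 2) - S n)" by simp
qed (use a(1) in auto)

lemma averaged_iteration_displacement:
  fixes N :: "'a::real_inner \<Rightarrow> 'a"
  assumes nonexp: "\<And>u v. norm (N u - N v) \<le> norm (u - v)" and fixed: "N z = z"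
    and \<alpha>: "0 < \<alpha>" "\<alpha> < 1"
    and x: "\<And>n. x (Suc n) = (1 - \<alpha>) *\<^sub>R x n + \<alpha> *\<^sub>R N (x n)"
  shows "(\<lambda>n. sqrt (real n) * norm (N (x n) - x n)) \<longlonglongrightarrow> 0"
proof -
  define d where "d n = norm (N (x n) - x n)" for n
  have "d (Suc n) \<le> d n" for n
  proof -
    have step: "x (Suc n) - x n = \<alpha> *\<^sub>R (N (x n) - x n)"
      "N (x n) - x (Suc n) = (1 - \<alpha>) *\<^sub>R (N (x n) - x n)"
      by (simp_all add: x algebra_simps)
    \<comment> \<open>Inserting \<open>N (x n)\<close> splits the displacement into parts of size at
      most \<alpha> d(n) and (1 - \<alpha>) d(n).\<close>
    have "d (Suc n) \<le> norm (N (x (Suc n)) - N (x n)) + norm (N (x n) - x (Suc n))"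
      unfolding d_def by (rule norm_diff_triangle_le[OF order_refl order_refl])
    also have "\<dots> \<le> norm (x (Suc n) - x n) + norm (N (x n) - x (Suc n))"
      using nonexp by simp
    also have "\<dots> = d n"
      unfolding step norm_scaleR d_def using \<alpha> by (simp add: algebra_simps)
    finally show ?thesis .
  qed
  then have mono: "antimono (\<lambda>n. \<alpha> * (1 - \<alpha>) * (d n)\<^sup>2)"
    using \<alpha> by (intro decseq_SucI mult_left_mono power_mono) (auto simp: d_def)
  have "\<alpha> * (1 - \<alpha>) * (d n)\<^sup>2 \<le> (norm (x n - z))\<^sup>2 - (norm (x (Suc n) - z))\<^sup>2" for n
  proof -
    define s t where "s = x n - z" and "t = N (x n) - z"
    have "norm t \<le> norm s" using nonexp[of "x n" z] by (simp add: fixed s_def t_def)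
    then have "\<alpha> * (norm t)\<^sup>2 \<le> \<alpha> * (norm s)\<^sup>2" using \<alpha> by (simp add: power_mono)
    moreover have "x (Suc n) - z = (1 - \<alpha>) *\<^sub>R s + \<alpha> *\<^sub>R t" "N (x n) - x n = t - s"
      by (simp_all add: x s_def t_def algebra_simps)
    \<comment> \<open>The squared norm of a convex combination; the subtracted term is the decrease
      of the squared distance to \<open>z\<close> that makes the sum telescope.\<close>
    moreover have "(norm ((1 - \<alpha>) *\<^sub>R s + \<alpha> *\<^sub>R t))\<^sup>2
        = (1 - \<alpha>) * (norm s)\<^sup>2 + \<alpha> * (norm t)\<^sup>2 - \<alpha> * (1 - \<alpha>) * (norm (t - s))\<^sup>2"
      by (simp add: power2_norm_eq_inner inner_diff_left inner_diff_right inner_add_left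
          inner_add_right inner_commute field_simps)
    ultimately show ?thesis
      by (simp add: d_def flip: s_def) (simp add: algebra_simps)
  qed
  with mono have "(\<lambda>n. real n * (\<alpha> * (1 - \<alpha>) * (d n)\<^sup>2)) \<longlonglongrightarrow> \<alpha> * (1 - \<alpha>) * 0"
    unfolding mult_zero_right using \<alpha> by (intro antimono_telescoping_little_o[where S = "\<lambda>n. (norm (x n - z))\<^sup>2"]) auto
  then have "(\<lambda>n. \<alpha> * (1 - \<alpha>) * (real n * (d n)\<^sup>2)) \<longlonglongrightarrow> \<alpha> * (1 - \<alpha>) * 0"
    unfolding mult.left_commute[of "real _" "\<alpha> * (1 - \<alpha>)"] .
  then have "(\<lambda>n. real n * (d n)\<^sup>2) \<longlonglongrightarrow> 0"
    using \<alpha> by (subst (asm) tendsto_mult_left_iff) auto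
  from tendsto_real_sqrt[OF this] show ?thesis
    by (simp add: real_sqrt_mult d_def)
qed

section \<open>The AAMR iteration\<close>

theorem theorem4p1:
  fixes A B :: "'a::{real_inner, complete_space} set"
    and x0 q :: 'a and \<alpha> \<beta> :: real and x y :: "nat \<Rightarrow> 'a"
  assumes "closed A" and "convex A" and "closed B" and "convex B"
    and "0 < \<alpha>" and "\<alpha> < 1" and "0 < \<beta>" and "\<beta> < 1"
    and "x 0 = x0"
    and "\<And>n. y n = metric_proj A (x n + q)"
    and "\<And>n. x (Suc n) = aamr (translate_by_minus A q) (translate_by_minus B q) \<alpha> \<beta> (x n)"
    and "A \<inter> B \<noteq> {}"
    and "q - metric_proj (A \<inter> B) q
           \<in> normal_cone A (metric_proj (A \<inter> B) q) + normal_cone B (metric_proj (A \<inter> B) q)"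
  shows "(\<forall>n. aamr_residual A B q (x n) = norm (y n - metric_proj B (y n))) \<and>
         (\<lambda>n. aamr_residual A B q (x n)) \<in> o(\<lambda>n. 1 / sqrt (real n)) \<and>
         (\<lambda>n. sqrt (real n) * aamr_residual A B q (x n)) \<longlonglongrightarrow> 0"
proof -
  let ?C = "translate_by_minus A q" and ?D = "translate_by_minus B q"
  define p where "p = metric_proj (A \<inter> B) q"
  define N where "N = modified_reflector ?D \<beta> \<circ> modified_reflector ?C \<beta>"
  have "A \<noteq> {}" "B \<noteq> {}" using assms(12) by auto
  note A = \<open>closed A\<close> \<open>convex A\<close> \<open>A \<noteq> {}\<close>
  note B = \<open>closed B\<close> \<open>convex B\<close> \<open>B \<noteq> {}\<close>
  have C: "closed ?C" "convex ?C" "?C \<noteq> {}" and D: "closed ?D" "convex ?D" "?D \<noteq> {}"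
    using A B by (simp_all add: closed_translate_by_minus convex_translate_by_minus
        translate_by_minus_eq_empty_iff)
  have nonexp: "norm (N s - N t) \<le> norm (s - t)" for s t
    unfolding N_def o_def using assms(7,8)
    by (intro order_trans[OF modified_reflector_nonexpansive[OF D]]
        modified_reflector_nonexpansive[OF C]) auto
  obtain u v where uv: "u \<in> normal_cone A p" "v \<in> normal_cone B p" "q - p = u + v"
    using assms(13) unfolding p_def by (auto elim: set_plus_elim)
  \<comment> \<open>After translation by \<open>q\<close> the common point is \<open>p - q\<close>,
    and the cone condition takes the form required by the fixed point lemma.\<close>
  have "- (p - q) = u + v" using uv(3) by simp
  then obtain z where "N z = z"
    unfolding N_def
    using modified_reflector_composition_fixpoint[of \<beta> u ?C "p - q" v ?D] uv(1,2) assms(8)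
    by (auto simp: normal_cone_translate_by_minus)
  then have lim: "(\<lambda>n. sqrt (real n) * norm (N (x n) - x n)) \<longlonglongrightarrow> 0"
    by (rule averaged_iteration_displacement[OF nonexp _ assms(5,6)])
      (simp add: assms(11) aamr_def N_def)
  have res_le: "aamr_residual A B q s \<le> norm (N s - s) / (2 * \<beta>)" for s
  proof -
    let ?a = "metric_proj A (s + q)"
    let ?b = "metric_proj B (modified_reflector ?C \<beta> s + q)"
    have "aamr_residual A B q s \<le> norm (?a - ?b)"
      \<comment> \<open>\<open>?b\<close> is one point of \<open>B\<close>, so its distance from
        \<open>?a\<close> bounds the distance from \<open>?a\<close> to \<open>B\<close>; the shifts
        by \<open>q\<close> cancel in the difference.\<close>
      unfolding aamr_residual_def by (rule metric_proj_le[OF B metric_proj_in[OF B]])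
    also have "\<dots> = norm (N s - s) / (2 * \<beta>)"
      unfolding N_def modified_reflector_composition_displacement
        metric_proj_translate_by_minus[OF A] metric_proj_translate_by_minus[OF B]
      using assms(7) by (simp add: norm_minus_commute)
    finally show ?thesis .
  qed
  have conv: "(\<lambda>n. sqrt (real n) * aamr_residual A B q (x n)) \<longlonglongrightarrow> 0"
  proof (rule tendsto_sandwich[where f = \<open>\<lambda>_. 0\<close>])
    show "(\<lambda>n. sqrt (real n) * norm (N (x n) - x n) / (2 * \<beta>)) \<longlonglongrightarrow> 0"
      using tendsto_divide[OF lim tendsto_const[of "2 * \<beta>"]] assms(7) by simp
    show "\<forall>\<^sub>F n in sequentially. sqrt (real n) * aamr_residual A B q (x n)
        \<le> sqrt (real n) * norm (N (x n) - x n) / (2 * \<beta>)"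
      using mult_left_mono[OF res_le, of "sqrt (real _)"] by simp
  qed (auto simp: aamr_residual_def)
  moreover have "(\<lambda>n. aamr_residual A B q (x n)) \<in> o(\<lambda>n. 1 / sqrt (real n))"
  proof (rule smalloI_tendsto)
    show "(\<lambda>n. aamr_residual A B q (x n) / (1 / sqrt (real n))) \<longlonglongrightarrow> 0"
      using conv by (simp add: mult.commute)
    \<comment> \<open>Only eventually: at n = 0 the quotient \<open>1 / sqrt 0\<close> is 0 by
      convention.\<close>
    show "\<forall>\<^sub>F n in sequentially. 1 / sqrt (real n) \<noteq> 0"
      using eventually_gt_at_top[of 0] by eventually_elim simp
  qed
  ultimately show ?thesis
    by (simp add: aamr_residual_def assms(10))
qed

end
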